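(* Let $q$ be a prime power, let $k,n,m$ be positive integers with $k\mid n$ and $n/k\ge 2$, and let $\gamma\in\mathbb{F}_{q^n}$ be a root of an irreducible polynomial of degree $n/k$ over $\mathbb{F}_{q^k}$ (so $\mathbb{F}_{q^n}=\mathbb{F}_{q^k}(\gamma)$). Let $U$ be an $\mathbb{F}_q$-subspace of $\mathbb{F}_{q^k}^2$ with $\dim_{\mathbb{F}_q}U=m$, and let $V=V_{U,\gamma}=\{u+v\gamma : (u,v)\in U\}\subseteq\mathbb{F}_{q^n}$. Then $V$ is a Sidon space if and only if $U$ has the Sidon space property with respect to $\gamma$.
   Context: An $\mathbb{F}_q$-subspace $V$ of $\mathbb{F}_{q^n}$ is a Sidon space if for all nonzero $a,b,c,d\in V$ with $ab=cd$ one has $\{a\mathbb{F}_q,b\mathbb{F}_q\}=\{c\mathbb{F}_q,d\mathbb{F}_q\}$, where $e\mathbb{F}_q=\{e\lambda:\lambda\in\mathbb{F}_q\}$. For $(u,v)\in U$ put $S^{\gamma}_{(u,v)}=\{\lambda\in\mathbb{F}_{q^n} : \lambda(u+v\gamma)\in V_{U,\gamma}\}$, an $\mathbb{F}_q$-subspace of $\mathbb{F}_{q^n}$ containing $\mathbb{F}_q$. The subspace $U$ has the Sidon space property with respect to $\gamma$ if for every $\mathbb{F}_q$-linearly independent $(u,v),(u',v')\in U$ one has $S^{\gamma}_{(u,v)}\cap S^{\gamma}_{(u',v')}=\mathbb{F}_q$. *)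

theory Defs
  imports
    "HOL-Number_Theory.Prime_Powers"
    "HOL-Algebra.Chinese_Remainder"
    "HOL-Algebra.Polynomial_Divisibility"
begin

text \<open>
  Throughout, \<open>R\<close> is the big field (with \<open>q ^ n\<close> elements), and the smaller fields are subsets of its
  carrier satisfying \<open>subfield\<close>.  Note that the library predicate \<open>subalgebra F V R\<close> only requires
  \<open>V\<close> to be an additive subgroup that is closed under multiplication by elements of \<open>F\<close>: it says
  that \<open>V\<close> is an \<open>F\<close>-subspace of \<open>R\<close>, not that \<open>V\<close> is closed under products.
\<close>

definition sidon_space :: "'a set \<Rightarrow> 'a set \<Rightarrow> ('a, 'b) ring_scheme \<Rightarrow> bool" where
  "sidon_space F V R \<longleftrightarrow>
     subalgebra F V R \<and>
     (\<forall>a \<in> V - {\<zero>\<^bsub>R\<^esub>}. \<forall>b \<in> V - {\<zero>\<^bsub>R\<^esub>}. \<forall>c \<in> V - {\<zero>\<^bsub>R\<^esub>}. \<forall>d \<in> V - {\<zero>\<^bsub>R\<^esub>}.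
        a \<otimes>\<^bsub>R\<^esub> b = c \<otimes>\<^bsub>R\<^esub> d \<longrightarrow>
        {a <#\<^bsub>R\<^esub> F, b <#\<^bsub>R\<^esub> F} = {c <#\<^bsub>R\<^esub> F, d <#\<^bsub>R\<^esub> F})"

text \<open>
  The library develops linear algebra over a subfield of a ring, with the ring multiplication as
  scaling.  To use it for spaces of pairs we work in the product ring \<open>RDirProd R R\<close> and let \<open>F\<close> act
  through its image on the diagonal: \<open>(c, c) \<otimes> (u, v) = (c \<otimes> u, c \<otimes> v)\<close>.
\<close>

definition diag_scalars :: "'a set \<Rightarrow> ('a \<times> 'a) set" where
  "diag_scalars F = (\<lambda>c. (c, c)) ` F"

definition V_space :: "('a, 'b) ring_scheme \<Rightarrow> ('a \<times> 'a) set \<Rightarrow> 'a \<Rightarrow> 'a set" where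
  "V_space R U \<gamma> = {u \<oplus>\<^bsub>R\<^esub> v \<otimes>\<^bsub>R\<^esub> \<gamma> | u v. (u, v) \<in> U}"

definition S_space :: "('a, 'b) ring_scheme \<Rightarrow> ('a \<times> 'a) set \<Rightarrow> 'a \<Rightarrow> 'a \<times> 'a \<Rightarrow> 'a set" where
  "S_space R U \<gamma> = (\<lambda>(u, v). {l \<in> carrier R. l \<otimes>\<^bsub>R\<^esub> (u \<oplus>\<^bsub>R\<^esub> v \<otimes>\<^bsub>R\<^esub> \<gamma>) \<in> V_space R U \<gamma>})"

definition sidon_space_property ::
  "'a set \<Rightarrow> ('a, 'b) ring_scheme \<Rightarrow> ('a \<times> 'a) set \<Rightarrow> 'a \<Rightarrow> bool" where
  "sidon_space_property F R U \<gamma> \<longleftrightarrow>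
     (\<forall>w \<in> U. \<forall>w' \<in> U. ring.independent (RDirProd R R) (diag_scalars F) [w, w'] \<longrightarrow>
        S_space R U \<gamma> w \<inter> S_space R U \<gamma> w' = F)"

end

theory Submission
  imports Defs
begin

text \<open>
  An equation \<open>a b = c d\<close> between nonzero elements of \<open>V\<close> says that \<open>l = d / a = b / c\<close> carries both \<open>a\<close>
  and \<open>c\<close> into \<open>V\<close>.  If \<open>a\<close> and \<open>c\<close> are proportional over \<open>F\<close>, then so are \<open>b\<close> and \<open>d\<close>; otherwise the
  intersection condition applied to \<open>a\<close> and \<open>c\<close> is exactly the statement \<open>l \<in> F\<close>.  Since \<open>\<gamma> \<notin> E\<close>, the
  \<open>F\<close>-linear map \<open>(u, v) \<mapsto> u + v \<gamma>\<close> is injective on \<open>U\<close>, so independence can be read off in \<open>V\<close>.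
\<close>

lemma RDirProd_simps [simp]:
  "carrier (RDirProd R S) = carrier R \<times> carrier S"
  "(a, b) \<otimes>\<^bsub>RDirProd R S\<^esub> (c, d) = (a \<otimes>\<^bsub>R\<^esub> c, b \<otimes>\<^bsub>S\<^esub> d)"
  "(a, b) \<oplus>\<^bsub>RDirProd R S\<^esub> (c, d) = (a \<oplus>\<^bsub>R\<^esub> c, b \<oplus>\<^bsub>S\<^esub> d)"
  "\<zero>\<^bsub>RDirProd R S\<^esub> = (\<zero>\<^bsub>R\<^esub>, \<zero>\<^bsub>S\<^esub>)"
  by (simp_all add: RDirProd_def DirProd_def monoid.defs)

text \<open>A root in \<open>K\<close> would split off a linear factor, impossible for an
  irreducible polynomial of degree other than 1. Only roots lying in \<open>K\<close> matter, so the
  argument runs in \<open>?K\<close>, where \<open>K\<close> is the whole carrier.\<close>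

lemma (in field) pirreducible_no_root_in_subfield:
  assumes K: "subfield K R" and p: "p \<in> carrier (K[X])" "pirreducible K p" "degree p \<noteq> 1"
    and a: "a \<in> K"
  shows "eval p a \<noteq> \<zero>"
proof
  let ?K = "R \<lparr> carrier := K \<rparr>"
  interpret K: field ?K
    using subfield_iff(2)[OF K] .
  note cons = univ_poly_consistent[OF subfieldE(1)[OF K]] eval_consistent[OF subfieldE(1)[OF K]]
  assume "eval p a = \<zero>"
  moreover have "p \<noteq> []"
    using pirreducibleE(1)[OF subfieldE(1)[OF K] p(1,2)] .
  ultimately have "K.is_root p a"
    using a by (simp add: K.is_root_def cons)
  moreover have "K.roots p = {#}"
    using K.pirreducible_roots[of p] p by (simp add: cons)
  ultimately show False
    using K.roots_mem_iff_is_root[of p a] p by (simp add: cons)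
qed

text \<open>The span of one vector is the set of its multiples. Since \<open>K\<close> may be any
  subset of the carrier, this applies to \<open>diag_scalars F\<close> without a proof that it is a
  subfield of the product ring.\<close>

lemma (in ring) independent_pair_iff:
  assumes "v \<in> carrier R" "K \<subseteq> carrier R"
  shows "independent K [u, v] \<longleftrightarrow> u \<in> carrier R \<and> v \<noteq> \<zero> \<and> u \<notin> K #> v"
proof -
  have "Span K [v] = K #> v"
    using assms by (force simp: line_extension_def set_add_def' r_coset_def)
  then show ?thesis
    using assms independent_backwards[of K u "[v]"] independent_backwards[of K v "[]"]
    by (auto intro!: li_Cons)
qed

text \<open>Being a multiple is symmetric because nonzero scalars are invertible in
  \<open>F\<close>. The hypothesis \<open>a \<noteq> \<zero>\<close> forces the scalar to be
  nonzero; zero itself lies in every \<open>b <# F\<close>.\<close>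

lemma (in field) l_coset_subfield_eq_iff:
  assumes F: "subfield F R" and "a \<in> carrier R" "b \<in> carrier R" "a \<noteq> \<zero>"
  shows "a <# F = b <# F \<longleftrightarrow> a \<in> b <# F"
proof
  have "a = a \<otimes> \<one>" "\<one> \<in> F"
    using assms subringE(3)[OF subfieldE(1)[OF F]] by auto
  then have "a \<in> a <# F"
    unfolding l_coset_def by blast
  then show "a \<in> b <# F" if "a <# F = b <# F"
    using that by simp
next
  assume "a \<in> b <# F"
  then obtain f where f: "f \<in> F" "a = b \<otimes> f"
    by (auto simp: l_coset_def)
  have FR: "F \<subseteq> carrier R"
    using subfieldE(3)[OF F] .
  have f0: "f \<in> F - {\<zero>}"
    using f assms by auto
  note inv = subfield_m_inv[OF F f0]
  note mult = subringE(6)[OF subfieldE(1)[OF F]]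
  have "a \<otimes> h \<in> b <# F" if "h \<in> F" for h
  proof -
    have "a \<otimes> h = b \<otimes> (f \<otimes> h)"
      using f that FR assms by (simp add: m_assoc subset_iff)
    then show ?thesis
      using mult[OF f(1) that] by (auto simp: l_coset_def)
  qed
  moreover have "b \<otimes> h \<in> a <# F" if "h \<in> F" for h
  proof -
    have c: "f \<in> carrier R" "inv f \<in> carrier R" "h \<in> carrier R"
      using f inv(1) that FR by auto
    have "a \<otimes> (inv f \<otimes> h) = b \<otimes> (f \<otimes> inv f) \<otimes> h"
      unfolding f(2) using c assms by (simp only: m_assoc m_closed)
    also have "\<dots> = b \<otimes> h"
      using inv(2) assms by simp
    finally show ?thesis
      using mult[of "inv f" h] inv(1) that unfolding l_coset_def by force
  qed
  ultimately show "a <# F = b <# F"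
    by (auto simp: l_coset_def)
qed

text \<open>This is the intersection condition expressed in \<open>V\<close> alone: the sets
  \<open>{l. l \<otimes> a \<in> V}\<close> become \<open>S_space\<close> once \<open>a\<close> is
  written as the image of a pair.\<close>

lemma (in field) sidon_space_iff:
  assumes F: "subfield F R" and V: "subalgebra F V R"
  shows "sidon_space F V R \<longleftrightarrow>
    (\<forall>a \<in> V. \<forall>b \<in> V. b \<noteq> \<zero> \<and> a \<notin> b <# F \<longrightarrow>
       {l \<in> carrier R. l \<otimes> a \<in> V} \<inter> {l \<in> carrier R. l \<otimes> b \<in> V} = F)"
    (is "_ \<longleftrightarrow> ?P")
proof -
  have FR: "F \<subseteq> carrier R" and VR: "V \<subseteq> carrier R"
    using subfieldE(3)[OF F] subalgebra_in_carrier[OF V] by auto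
  have zF: "\<zero> \<in> F"
    using subringE(2)[OF subfieldE(1)[OF F]] .
  show ?thesis
  proof
    assume S: "sidon_space F V R"
    have "l \<in> F"
      if ab: "a \<in> V" "b \<in> V" "b \<noteq> \<zero>" "a \<notin> b <# F"
        and l: "l \<in> carrier R" "l \<otimes> a \<in> V" "l \<otimes> b \<in> V" for a b l
    \<comment> \<open>A zero \<open>l\<close> is set apart, because the Sidon condition speaks only
      of nonzero elements.\<close>
    proof (cases "l = \<zero>")
      case False
      have c: "a \<in> carrier R" "b \<in> carrier R"
        using ab VR by auto
      have "b \<otimes> \<zero> \<in> b <# F"
        using zF unfolding l_coset_def by blast
      then have a0: "a \<noteq> \<zero>"
        using ab c by auto
      have "a \<otimes> (l \<otimes> b) = b \<otimes> (l \<otimes> a)"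
        using c l by (simp add: m_lcomm m_comm)
      moreover have "l \<otimes> a \<noteq> \<zero>" "l \<otimes> b \<noteq> \<zero>"
        using False a0 ab c l integral_iff by auto
      ultimately have "{a <# F, (l \<otimes> b) <# F} = {b <# F, (l \<otimes> a) <# F}"
        using S ab a0 l unfolding sidon_space_def by (meson DiffI singletonD)
      \<comment> \<open>Since these two cosets differ, the equality of unordered pairs must match
        \<open>a <# F\<close> with \<open>(l \<otimes> a) <# F\<close>; cancelling \<open>a\<close>
        then puts \<open>l\<close> in \<open>F\<close>.\<close>
      moreover have "a <# F \<noteq> b <# F"
        using l_coset_subfield_eq_iff[OF F c a0] ab by simp
      ultimately have "(l \<otimes> a) <# F = a <# F"
        by (auto simp: doubleton_eq_iff)
      then have "l \<otimes> a \<in> a <# F"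
        using l_coset_subfield_eq_iff[OF F _ c(1) \<open>l \<otimes> a \<noteq> \<zero>\<close>] l c by simp
      then obtain f where "f \<in> F" "l \<otimes> a = a \<otimes> f"
        by (auto simp: l_coset_def)
      then have "a \<otimes> l = a \<otimes> f"
        using c l by (simp add: m_comm)
      then show ?thesis
        using m_lcancel[OF a0 c(1) l(1)] \<open>f \<in> F\<close> FR by auto
    qed (use zF in simp)
    \<comment> \<open>The reverse inclusion is closure of \<open>V\<close> under scaling by
      \<open>F\<close>.\<close>
    then show ?P
      using FR subalgebra.smult_closed[OF V] by blast
  next
    assume P: ?P
    have coset_eq: "x <# F = y <# F"
      if "x = y \<otimes> f" "f \<in> F" "x \<in> V - {\<zero>}" "y \<in> V" for x y f
      using that VR l_coset_subfield_eq_iff[OF F, of x y] unfolding l_coset_def by blast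
    have "{a <# F, b <# F} = {c <# F, d <# F}"
      if abcd: "a \<in> V - {\<zero>}" "b \<in> V - {\<zero>}" "c \<in> V - {\<zero>}" "d \<in> V - {\<zero>}"
        and eq: "a \<otimes> b = c \<otimes> d" for a b c d
    proof -
      have car: "a \<in> carrier R" "b \<in> carrier R" "c \<in> carrier R" "d \<in> carrier R"
        using abcd VR by auto
      define l where "l = d \<otimes> inv a"
      have ainv: "inv a \<in> carrier R" "inv a \<otimes> a = \<one>"
        using abcd car field_Units by auto
      have l: "l \<in> carrier R"
        using car ainv by (simp add: l_def)
      have la: "l \<otimes> a = d"
        using car ainv by (simp add: l_def m_assoc)
      have "a \<otimes> (l \<otimes> c) = c \<otimes> (l \<otimes> a)"
        using car l by (simp add: m_lcomm m_comm)
      then have "a \<otimes> (l \<otimes> c) = a \<otimes> b"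
        by (simp add: la eq)
      then have lc: "l \<otimes> c = b"
        using abcd car l m_lcancel by auto
      have cosets: "d <# F = a <# F" "b <# F = c <# F" if "l \<in> F"
        using that la lc abcd car l coset_eq[of d a l] coset_eq[of b c l] by (auto simp: m_comm)
      show ?thesis
      \<comment> \<open>The cases give the two possible matchings: \<open>a\<close> with
        \<open>c\<close> and \<open>b\<close> with \<open>d\<close> if \<open>a\<close> and
        \<open>c\<close> are proportional, otherwise \<open>a\<close> with \<open>d\<close> and
        \<open>b\<close> with \<open>c\<close>.\<close>
      proof (cases "a \<in> c <# F")
        case True
        then obtain f where f: "f \<in> F" "a = c \<otimes> f"
          by (auto simp: l_coset_def)
        have "c \<otimes> (f \<otimes> b) = c \<otimes> d"
          using eq f FR car by (auto simp: m_assoc subset_iff)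
        then have "d = b \<otimes> f"
          using m_lcancel[of c "f \<otimes> b" d] abcd car f FR by (auto simp: m_comm subset_iff)
        then have "d <# F = b <# F"
          using coset_eq f abcd by blast
        moreover have "a <# F = c <# F"
          using True car abcd by (auto simp: l_coset_subfield_eq_iff[OF F])
        ultimately show ?thesis
          by simp
      next
        case False
        then have "l \<in> F"
          using P abcd l la lc by blast
        then show ?thesis
          using cosets by auto
      qed
    qed
    then show "sidon_space F V R"
      using V unfolding sidon_space_def by blast
  qed
qed

definition V_map :: "('a, 'b) ring_scheme \<Rightarrow> 'a \<Rightarrow> 'a \<times> 'a \<Rightarrow> 'a" where
  "V_map R \<gamma> = (\<lambda>(u, v). u \<oplus>\<^bsub>R\<^esub> v \<otimes>\<^bsub>R\<^esub> \<gamma>)"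

lemma V_space_eq_image: "V_space R U \<gamma> = V_map R \<gamma> ` U"
  by (force simp: V_space_def V_map_def)

lemma S_space_eq: "S_space R U \<gamma> w = {l \<in> carrier R. l \<otimes>\<^bsub>R\<^esub> V_map R \<gamma> w \<in> V_space R U \<gamma>}"
  by (cases w) (simp add: S_space_def V_map_def)

text \<open>If two pairs with different second entries had the same image, \<gamma> would be a
  quotient of elements of \<open>E\<close>.\<close>

lemma (in field) V_map_inj_on:
  assumes E: "subfield E R" and \<gamma>: "\<gamma> \<in> carrier R - E"
  shows "inj_on (V_map R \<gamma>) (E \<times> E)"
proof (rule inj_onI, clarify)
  fix u v u' v'
  assume uv: "u \<in> E" "v \<in> E" "u' \<in> E" "v' \<in> E" and eq: "V_map R \<gamma> (u, v) = V_map R \<gamma> (u', v')"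
  note sub = subringE[OF subfieldE(1)[OF E]]
  have c: "u \<in> carrier R" "v \<in> carrier R" "u' \<in> carrier R" "v' \<in> carrier R" "\<gamma> \<in> carrier R"
    using uv sub(1) \<gamma> by auto
  \<comment> \<open>The same \<open>u\<close> is added to both terms so that, after the first is
    replaced by \<open>u' \<oplus> v' \<otimes> \<gamma>\<close>, the multiples of \<gamma> cancel
    and an element of \<open>E\<close> remains.\<close>
  have "(v \<ominus> v') \<otimes> \<gamma> = (u \<oplus> v \<otimes> \<gamma>) \<ominus> (u \<oplus> v' \<otimes> \<gamma>)"
    using c by algebra
  also have "u \<oplus> v \<otimes> \<gamma> = u' \<oplus> v' \<otimes> \<gamma>"
    using eq by (simp add: V_map_def)
  also have "(u' \<oplus> v' \<otimes> \<gamma>) \<ominus> (u \<oplus> v' \<otimes> \<gamma>) = u' \<ominus> u"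
    using c by algebra
  finally have "(v \<ominus> v') \<otimes> \<gamma> \<in> E"
    using uv sub(5,7) by (simp add: a_minus_def)
  moreover have "v \<ominus> v' \<in> E"
    using uv sub(5,7) by (simp add: a_minus_def)
  ultimately have "v \<ominus> v' = \<zero>"
    using subfield_m_inv_simprule[OF E, of "v \<ominus> v'" \<gamma>] \<gamma> by blast
  then have v: "v = v'"
    using c by (simp add: r_right_minus_eq)
  then have "u = u'"
    using eq c by (simp add: V_map_def)
  with v show "u = u' \<and> v = v'"
    by simp
qed

lemma (in field) V_map_smult:
  assumes "c \<in> carrier R" "w \<in> carrier R \<times> carrier R" "\<gamma> \<in> carrier R"
  shows "V_map R \<gamma> ((c, c) \<otimes>\<^bsub>RDirProd R R\<^esub> w) = c \<otimes> V_map R \<gamma> w"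
  using assms by (auto simp: V_map_def r_distr m_assoc)

text \<open>\<open>V_map\<close> is additive and turns the diagonal action on pairs into
  multiplication by \<open>F\<close>, so it sends subspaces to subspaces.\<close>

lemma (in field) V_space_subalgebra:
  assumes F: "subfield F R" and U: "subalgebra (diag_scalars F) U (RDirProd R R)"
    and \<gamma>: "\<gamma> \<in> carrier R"
  shows "subalgebra F (V_space R U \<gamma>) R"
proof -
  interpret P: ring "RDirProd R R"
    using RDirProd_ring[OF ring_axioms ring_axioms] .
  have UR: "U \<subseteq> carrier R \<times> carrier R"
    using P.subalgebra_in_carrier[OF U] by simp
  have hom: "V_map R \<gamma> \<in> hom (add_monoid (RDirProd R R)) (add_monoid R)"
    using \<gamma> by (auto simp: hom_def V_map_def l_distr a_ac DirProd_def)
  interpret h: group_hom "add_monoid (RDirProd R R)" "add_monoid R" "V_map R \<gamma>"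
    using hom P.add.group_axioms add.group_axioms
    by (simp add: group_hom_def group_hom_axioms_def)
  have "subgroup (V_map R \<gamma> ` U) (add_monoid R)"
    using h.subgroup_img_is_subgroup[OF subalgebra.axioms(1)[OF U]] .
  moreover have "c \<otimes> V_map R \<gamma> w \<in> V_map R \<gamma> ` U" if "c \<in> F" "w \<in> U" for c w
  proof -
    have "(c, c) \<otimes>\<^bsub>RDirProd R R\<^esub> w \<in> U"
      using subalgebra.smult_closed[OF U, of "(c, c)" w] that by (simp add: diag_scalars_def)
    moreover have "c \<in> carrier R" "w \<in> carrier R \<times> carrier R"
      using that UR subfieldE(3)[OF F] by auto
    ultimately show ?thesis
      using V_map_smult[of c w \<gamma>] \<gamma> by (metis image_eqI)
  qed
  ultimately show ?thesis
    unfolding V_space_eq_image by (auto simp: subalgebra_def subalgebra_axioms_def)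
qed

lemma (in field) independent_pair_V_map_iff:
  assumes F: "subfield F R" and E: "subfield E R" and \<gamma>: "\<gamma> \<in> carrier R - E"
    and UE: "U \<subseteq> E \<times> E" and U: "subalgebra (diag_scalars F) U (RDirProd R R)"
    and w: "w \<in> U" "w' \<in> U"
  shows "ring.independent (RDirProd R R) (diag_scalars F) [w, w'] \<longleftrightarrow>
    V_map R \<gamma> w' \<noteq> \<zero> \<and> V_map R \<gamma> w \<notin> V_map R \<gamma> w' <# F"
proof -
  interpret P: ring "RDirProd R R"
    using RDirProd_ring[OF ring_axioms ring_axioms] .
  note FR = subfieldE(3)[OF F] and ER = subfieldE(3)[OF E]
  have c: "w \<in> carrier R \<times> carrier R" "w' \<in> carrier R \<times> carrier R"
    using w UE ER by auto
  have inj: "V_map R \<gamma> x = V_map R \<gamma> y \<longleftrightarrow> x = y" if "x \<in> U" "y \<in> U" for x y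
    using inj_on_eq_iff[OF inj_on_subset[OF V_map_inj_on[OF E \<gamma>] UE]] that by blast
  have "(\<zero>, \<zero>) \<in> U"
    using subgroup.one_closed[OF subalgebra.axioms(1)[OF U]] by (simp add: DirProd_def)
  then have zero: "V_map R \<gamma> w' = \<zero> \<longleftrightarrow> w' = (\<zero>, \<zero>)"
    using inj[of w' "(\<zero>, \<zero>)"] w \<gamma> by (simp add: V_map_def)
  \<comment> \<open>Injectivity applies because \<open>U\<close> contains the scaled pair.
    Commutativity reconciles the scalar on the right in \<open><#\<close> with the scalar on the
    left in \<open>#>\<close>.\<close>
  have scale: "V_map R \<gamma> w = V_map R \<gamma> w' \<otimes> f \<longleftrightarrow> w = (f, f) \<otimes>\<^bsub>RDirProd R R\<^esub> w'"
    if f: "f \<in> F" for f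
  proof -
    have "(f, f) \<otimes>\<^bsub>RDirProd R R\<^esub> w' \<in> U"
      using subalgebra.smult_closed[OF U, of "(f, f)" w'] f w by (simp add: diag_scalars_def)
    moreover have "V_map R \<gamma> w' \<otimes> f = V_map R \<gamma> ((f, f) \<otimes>\<^bsub>RDirProd R R\<^esub> w')"
      using V_map_smult[of f w' \<gamma>] f FR c \<gamma> by (auto simp: V_map_def m_comm)
    ultimately show ?thesis
      using inj w by simp
  qed
  have "diag_scalars F \<subseteq> carrier (RDirProd R R)"
    using FR by (auto simp: diag_scalars_def)
  then have "P.independent (diag_scalars F) [w, w'] \<longleftrightarrow>
      w' \<noteq> (\<zero>, \<zero>) \<and> w \<notin> diag_scalars F #>\<^bsub>RDirProd R R\<^esub> w'"
    using P.independent_pair_iff[of w' "diag_scalars F" w] c by simp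
  then show ?thesis
    using zero scale by (auto simp: r_coset_def l_coset_def diag_scalars_def)
qed

theorem theorem3p3:
  fixes R :: "('a, 'b) ring_scheme" (structure)
    and F E :: "'a set" and U :: "('a \<times> 'a) set" and \<gamma> :: 'a and p :: "'a list"
    and q k n m :: nat
  assumes "primepow q" and "k > 0" and "n > 0" and "m > 0" and "k dvd n" and "n div k \<ge> 2"
    and "field R" and "card (carrier R) = q ^ n"
    and "subfield F R" and "card F = q"
    and "subfield E R" and "card E = q ^ k"
    and "\<gamma> \<in> carrier R"
    and "p \<in> carrier (E[X])" and "pirreducible E p" and "degree p = n div k"
    and "ring.eval R p \<gamma> = \<zero>"
    and "U \<subseteq> E \<times> E" and "subalgebra (diag_scalars F) U (RDirProd R R)"
    and "ring.dimension (RDirProd R R) m (diag_scalars F) U"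
  shows "sidon_space F (V_space R U \<gamma>) R \<longleftrightarrow> sidon_space_property F R U \<gamma>"
proof -
  interpret field R
    by fact
  \<comment> \<open>The degree \<open>n div k\<close> is at least 2, hence not 1.\<close>
  have "\<gamma> \<notin> E"
    using pirreducible_no_root_in_subfield[OF \<open>subfield E R\<close>, of p \<gamma>] assms by auto
  then have "\<gamma> \<in> carrier R - E"
    using assms by simp
  note indep = independent_pair_V_map_iff[OF \<open>subfield F R\<close> \<open>subfield E R\<close> this
      \<open>U \<subseteq> E \<times> E\<close> \<open>subalgebra (diag_scalars F) U (RDirProd R R)\<close>]
  have "subalgebra F (V_space R U \<gamma>) R"
    using V_space_subalgebra assms by blast
  \<comment> \<open>Quantifying over the image \<open>V_space\<close> amounts to quantifying over
    \<open>U\<close>, and \<open>indep\<close> makes the side conditions on the two pairs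
    agree.\<close>
  from sidon_space_iff[OF \<open>subfield F R\<close> this] show ?thesis
    by (simp add: sidon_space_property_def indep S_space_eq) (simp add: V_space_eq_image)
qed

end
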